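(* For every insertion parameter $\beta\in[0,1)$ and every $\delta>0$ there exists a finite constant $C=C(\beta,\delta)$ such that for every integer $n\ge 1$, setting $T=\lceil\exp(C n^{1/3})\rceil$, there exists an estimator $\widehat{X}$ (a function of $T$ finite binary strings, with values in $\{0,1\}^n$) such that for every $x\in\{0,1\}^n$, $$\mathbb{P}_x\bigl[\widehat{X}(X^{*,1},\dots,X^{*,T})=x\bigr]\ \ge\ 1-\delta,$$ where under $\mathbb{P}_x$ the strings $X^{*,1},\dots,X^{*,T}$ are i.i.d. outputs of the insertion channel with insertion parameter $\beta$ applied to $x$.
   Context: Insertion channel with insertion parameter $\beta=1-\alpha$: let $G_0,G_1,\dots,G_n$ be i.i.d. with the Geometric$(\alpha)$ distribution, $\mathbb{P}(G_k=\ell)=\alpha\beta^{\ell-1}$ for all integers $\ell\ge1$ (with the convention $0^0=1$). Given an input $x=(x_0,\dots,x_{n-1})\in\{0,1\}^n$, the output $X^*$ is the string consisting of $G_0-1$ i.i.d. fair bits, followed by $x_0$, followed by $G_1-1$ i.i.d. fair bits, followed by $x_1$, and so on, ending with $x_{n-1}$ followed by $G_n-1$ i.i.d. fair bits; all inserted fair bits (uniform on $\{0,1\}$) are independent of each other and of the $G_k$. *)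

theory Defs
  imports "HOL-Probability.Probability"
begin

text \<open>
  The library's \<^const>\<open>geometric_pmf\<close> counts failures before the first success
  and so is supported on the naturals from 0; the shift by one yields the
  distribution on the positive integers.
\<close>

definition gap_pmf :: "real \<Rightarrow> nat pmf" where
  "gap_pmf \<beta> = map_pmf Suc (geometric_pmf (1 - \<beta>))"

lemma pmf_gap_pmf:
  assumes "0 \<le> \<beta>" "\<beta> < 1" "1 \<le> l"
  shows "pmf (gap_pmf \<beta>) l = (1 - \<beta>) * \<beta> ^ (l - 1)"
proof -
  obtain k where "l = Suc k"
    using assms(3) by (cases l) auto
  then show ?thesis
    using assms by (simp add: gap_pmf_def pmf_map_inj')
qed

definition inserted_bits_pmf :: "real \<Rightarrow> bool list pmf" where
  "inserted_bits_pmf \<beta> =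
     do {g \<leftarrow> gap_pmf \<beta>; replicate_pmf (g - 1) (pmf_of_set (UNIV :: bool set))}"

primrec insertion_channel :: "real \<Rightarrow> bool list \<Rightarrow> bool list pmf" where
  "insertion_channel \<beta> [] = inserted_bits_pmf \<beta>"
| "insertion_channel \<beta> (b # x) =
     do {u \<leftarrow> inserted_bits_pmf \<beta>; v \<leftarrow> insertion_channel \<beta> x; return_pmf (u @ b # v)}"

end

theory Submission
  imports Defs "HOL-Complex_Analysis.Complex_Analysis"
begin

text \<open>
  Encode bits as signs. Inserted bits have mean sign zero, so for \<open>\<bar>w\<bar> < 1\<close> the generating function
  of the mean output signs is \<open>\<psi>(w) P\<^sub>x(w \<psi>(w))\<close>, where \<open>P\<^sub>x\<close> is the sign polynomial of the input and
  \<open>\<psi>(w) = (1 - \<beta>) / (1 - \<beta> w)\<close> is the transform of the number of insertions in one gap.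

  If \<open>x\<close> and \<open>y\<close> first differ at position \<open>m\<close>, then \<open>P\<^sub>x(z) - P\<^sub>y(z) = z\<^sup>m A(z)\<close> with \<open>\<bar>A(0)\<bar> = 2\<close> and
  \<open>\<bar>A(z)\<bar> \<le> 2 / (1 - \<bar>z\<bar>)\<close>. Substitute \<open>w = r v (1 + v) / 2\<close> with \<open>\<bar>v\<bar> = 1\<close>, so that \<open>\<bar>w\<bar>\<close> touches \<open>1\<close> only
  quadratically as \<open>v\<close> tends to \<open>1\<close>; then \<open>A(w \<psi>(w)) (1 - v)\<^sup>2 / 2\<close> has modulus \<open>1\<close> at \<open>v = 0\<close> and at most \<open>8\<close>
  on the unit circle. The maximum principle, applied to the product of its \<open>N\<close> rotations, yields a
  point \<open>v\<close> of the circle at distance \<open>O(1/N)\<close> from \<open>1\<close> where this function is at least \<open>8\<close> to the power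
  \<open>-N\<close>. There \<open>1 - \<bar>w \<psi>(w)\<bar> = O(1/N\<^sup>2)\<close>, so the factor \<open>z\<^sup>m\<close> costs only \<open>exp(-O(n/N\<^sup>2))\<close>. With \<open>N\<close> of order
  \<open>n\<close> to the \<open>1/3\<close>, the mean signs of \<open>x\<close> and \<open>y\<close> differ by \<open>exp(-O(N))\<close> at some position below \<open>O(N\<^sup>3)\<close>;
  empirical means with Chebyshev's inequality then identify the input.
\<close>

section \<open>Expectations of bounded functions under pmfs\<close>

lemma integrable_pmf_bounded:
  fixes f :: "'a \<Rightarrow> 'b::{banach, second_countable_topology}"
  assumes "\<And>x. x \<in> set_pmf p \<Longrightarrow> norm (f x) \<le> B"
  shows "integrable (measure_pmf p) f"
  by (rule measure_pmf.integrable_const_bound[where B = B]) (auto simp: AE_measure_pmf_iff assms)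

lemma norm_expectation_pmf_le:
  fixes f :: "'a \<Rightarrow> 'b::{banach, second_countable_topology}"
  assumes "\<And>x. x \<in> set_pmf p \<Longrightarrow> norm (f x) \<le> B"
  shows "norm (measure_pmf.expectation p f) \<le> B"
proof -
  have "norm (measure_pmf.expectation p f) \<le> measure_pmf.expectation p (\<lambda>x. norm (f x))"
    by (rule integral_norm_bound)
  also have "\<dots> \<le> measure_pmf.expectation p (\<lambda>_. B)"
    by (intro integral_mono_AE measure_pmf.integrable_const integrable_pmf_bounded[where B = B] AE_pmfI)
       (auto simp: assms)
  finally show ?thesis by simp
qed

lemma expectation_bind_pmf_real:
  fixes f :: "'b \<Rightarrow> real"
  assumes bound: "\<And>x y. x \<in> set_pmf p \<Longrightarrow> y \<in> set_pmf (q x) \<Longrightarrow> \<bar>f y\<bar> \<le> B"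
  shows "measure_pmf.expectation (bind_pmf p q) f =
         measure_pmf.expectation p (\<lambda>x. measure_pmf.expectation (q x) f)"
proof -
  \<comment> \<open>\<open>integral_bind\<close> asks for a bound everywhere, while
    \<open>bound\<close> controls \<open>f\<close> only on the support. Cutting \<open>f\<close> off
    to 0 above \<open>B\<close> changes neither side, since \<open>g\<close> and \<open>f\<close>
    agree almost surely.\<close>
  define g where "g y = (if \<bar>f y\<bar> \<le> B then f y else 0)" for y
  obtain x0 y0 where "x0 \<in> set_pmf p" "y0 \<in> set_pmf (q x0)"
    by (meson set_pmf_not_empty ex_in_conv)
  then have "B \<ge> 0" using bound by fastforce
  have "measure_pmf.expectation (bind_pmf p q) f = measure_pmf.expectation (bind_pmf p q) g"
    by (intro integral_cong_AE AE_pmfI) (auto simp: g_def dest: bound)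
  also have "\<dots> = measure_pmf.expectation p (\<lambda>x. measure_pmf.expectation (q x) g)"
    unfolding measure_pmf_bind
    by (rule integral_bind[where K = "count_space UNIV" and B = B and B' = 1])
       (auto simp: g_def \<open>B \<ge> 0\<close> measure_pmf.finite_measure_axioms measure_pmf_in_subprob_space)
  also have "\<dots> = measure_pmf.expectation p (\<lambda>x. measure_pmf.expectation (q x) f)"
    by (intro integral_cong_AE AE_pmfI) (auto simp: g_def dest: bound)
  finally show ?thesis .
qed

lemma expectation_bind_pmf_complex:
  fixes f :: "'b \<Rightarrow> complex"
  assumes bound: "\<And>x y. x \<in> set_pmf p \<Longrightarrow> y \<in> set_pmf (q x) \<Longrightarrow> norm (f y) \<le> B"
  shows "measure_pmf.expectation (bind_pmf p q) f =
         measure_pmf.expectation p (\<lambda>x. measure_pmf.expectation (q x) f)"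
proof -
  have int: "integrable (measure_pmf (q x)) f" if "x \<in> set_pmf p" for x
    using that by (auto intro!: integrable_pmf_bounded[where B = B] bound)
  have int_bind: "integrable (measure_pmf (bind_pmf p q)) f"
    by (rule integrable_pmf_bounded[where B = B]) (auto intro: bound)
  have int_outer: "integrable (measure_pmf p) (\<lambda>x. measure_pmf.expectation (q x) f)"
    by (rule integrable_pmf_bounded[where B = B], rule norm_expectation_pmf_le) (auto intro: bound)
  \<comment> \<open>\<open>L\<close> stands for \<open>Re\<close> and \<open>Im\<close>; the
    real-valued result applies to each of them because \<open>le\<close> transfers the bound
    \<open>B\<close>.\<close>
  have component: "L (measure_pmf.expectation (bind_pmf p q) f) =
      L (measure_pmf.expectation p (\<lambda>x. measure_pmf.expectation (q x) f))"
    if L: "bounded_linear L" and le: "\<And>z. \<bar>L z\<bar> \<le> norm z" for L :: "complex \<Rightarrow> real"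
  proof -
    have "L (measure_pmf.expectation (bind_pmf p q) f) =
        measure_pmf.expectation (bind_pmf p q) (\<lambda>y. L (f y))"
      using integral_bounded_linear[OF L int_bind] by simp
    also have "\<dots> = measure_pmf.expectation p (\<lambda>x. measure_pmf.expectation (q x) (\<lambda>y. L (f y)))"
      by (rule expectation_bind_pmf_real[where B = B]) (meson bound le order_trans)
    also have "\<dots> = measure_pmf.expectation p (\<lambda>x. L (measure_pmf.expectation (q x) f))"
      by (intro integral_cong_AE AE_pmfI) (auto simp: integral_bounded_linear[OF L int])
    also have "\<dots> = L (measure_pmf.expectation p (\<lambda>x. measure_pmf.expectation (q x) f))"
      by (rule integral_bounded_linear[OF L int_outer])
    finally show ?thesis .
  qed
  show ?thesis
    using component[OF bounded_linear_Re abs_Re_le_cmod] component[OF bounded_linear_Im abs_Im_le_cmod]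
    by (rule complex_eqI)
qed

section \<open>Second moments and Chebyshev's inequality for independent samples\<close>

lemma abs_sum_list_le:
  fixes f :: "'a \<Rightarrow> real"
  assumes "\<And>y. y \<in> set ys \<Longrightarrow> \<bar>f y\<bar> \<le> c"
  shows "\<bar>\<Sum>y\<leftarrow>ys. f y\<bar> \<le> real (length ys) * c"
  using assms
proof (induction ys)
  case (Cons y ys)
  then have "\<bar>f y\<bar> \<le> c" "\<bar>\<Sum>y\<leftarrow>ys. f y\<bar> \<le> real (length ys) * c" by auto
  then show ?case by (auto simp: algebra_simps)
qed simp

lemma expectation_replicate_pmf_Suc:
  fixes f :: "'a list \<Rightarrow> real"
  assumes "\<And>y ys. y \<in> set_pmf p \<Longrightarrow> ys \<in> set_pmf (replicate_pmf n p) \<Longrightarrow> \<bar>f (y # ys)\<bar> \<le> B"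
  shows "measure_pmf.expectation (replicate_pmf (Suc n) p) f =
    measure_pmf.expectation p (\<lambda>y. measure_pmf.expectation (replicate_pmf n p) (\<lambda>ys. f (y # ys)))"
proof -
  have eq: "replicate_pmf (Suc n) p = bind_pmf p (\<lambda>y. map_pmf ((#) y) (replicate_pmf n p))"
    by (simp add: map_pmf_def)
  show ?thesis
    unfolding eq by (subst expectation_bind_pmf_real[where B = B]) (auto intro: assms)
qed

text \<open>Split off the first sample: as \<open>f\<close> is centred, the cross term between it
  and the remaining sum has mean zero, so variances add.\<close>

lemma moments_sum_list_replicate_pmf:
  fixes f :: "'a \<Rightarrow> real"
  assumes bound: "\<And>y. \<bar>f y\<bar> \<le> c" and mean: "measure_pmf.expectation p f = 0"
  shows "measure_pmf.expectation (replicate_pmf n p) (\<lambda>ys. \<Sum>y\<leftarrow>ys. f y) = 0"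
    and "measure_pmf.expectation (replicate_pmf n p) (\<lambda>ys. (\<Sum>y\<leftarrow>ys. f y)\<^sup>2) =
           real n * measure_pmf.expectation p (\<lambda>y. (f y)\<^sup>2)"
proof (induction n)
  case 0
  show "measure_pmf.expectation (replicate_pmf 0 p) (\<lambda>ys. \<Sum>y\<leftarrow>ys. f y) = 0" by simp
  show "measure_pmf.expectation (replicate_pmf 0 p) (\<lambda>ys. (\<Sum>y\<leftarrow>ys. f y)\<^sup>2) =
           real 0 * measure_pmf.expectation p (\<lambda>y. (f y)\<^sup>2)" by simp
next
  case (Suc n)
  have sum_bound: "\<bar>\<Sum>y\<leftarrow>ys. f y\<bar> \<le> real n * c" if "ys \<in> set_pmf (replicate_pmf n p)" for ys
    using abs_sum_list_le[of ys f c] bound that by (auto simp: set_replicate_pmf)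
  have sq_bound: "(\<Sum>y\<leftarrow>ys. f y)\<^sup>2 \<le> (real n * c)\<^sup>2" if "ys \<in> set_pmf (replicate_pmf n p)" for ys
    using power_mono[OF sum_bound[OF that] abs_ge_zero, of 2] by simp
  have f_int: "integrable (measure_pmf p) f" "integrable (measure_pmf p) (\<lambda>y. (f y)\<^sup>2)"
    by (rule integrable_pmf_bounded[where B = c], use bound in simp,
        rule integrable_pmf_bounded[where B = "c\<^sup>2"], use power_mono[OF bound abs_ge_zero, of _ 2] in simp)
  have sum_int: "integrable (measure_pmf (replicate_pmf n p)) (\<lambda>ys. \<Sum>y\<leftarrow>ys. f y)"
    "integrable (measure_pmf (replicate_pmf n p)) (\<lambda>ys. (\<Sum>y\<leftarrow>ys. f y)\<^sup>2)"
    by (rule integrable_pmf_bounded[where B = "real n * c"], use sum_bound in simp,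
        rule integrable_pmf_bounded[where B = "(real n * c)\<^sup>2"], use sq_bound in simp)
  have cons_bound: "\<bar>\<Sum>z\<leftarrow>y # ys. f z\<bar> \<le> c + real n * c"
    if "ys \<in> set_pmf (replicate_pmf n p)" for y ys
    using sum_bound[OF that] bound[of y] by simp
  have "measure_pmf.expectation (replicate_pmf (Suc n) p) (\<lambda>ys. \<Sum>y\<leftarrow>ys. f y) =
      measure_pmf.expectation p (\<lambda>y. f y + 0)"
    by (subst expectation_replicate_pmf_Suc[where B = "c + real n * c"])
       (use cons_bound sum_int Suc.IH in auto)
  then show "measure_pmf.expectation (replicate_pmf (Suc n) p) (\<lambda>ys. \<Sum>y\<leftarrow>ys. f y) = 0"
    by (simp add: mean)
  have "measure_pmf.expectation (replicate_pmf (Suc n) p) (\<lambda>ys. (\<Sum>y\<leftarrow>ys. f y)\<^sup>2) =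
      measure_pmf.expectation p (\<lambda>y. measure_pmf.expectation (replicate_pmf n p)
        (\<lambda>ys. (\<Sum>z\<leftarrow>y # ys. f z)\<^sup>2))"
    using power_mono[OF cons_bound abs_ge_zero, of _ _ 2]
    by (intro expectation_replicate_pmf_Suc[where B = "(c + real n * c)\<^sup>2"]) simp
  also have "\<dots> = measure_pmf.expectation p (\<lambda>y. (f y)\<^sup>2 +
      real n * measure_pmf.expectation p (\<lambda>y. (f y)\<^sup>2))"
  proof (rule Bochner_Integration.integral_cong[OF refl])
    fix y
    have "measure_pmf.expectation (replicate_pmf n p) (\<lambda>ys. (\<Sum>z\<leftarrow>y # ys. f z)\<^sup>2) =
       measure_pmf.expectation (replicate_pmf n p)
         (\<lambda>ys. (f y)\<^sup>2 + 2 * f y * (\<Sum>y\<leftarrow>ys. f y) + (\<Sum>y\<leftarrow>ys. f y)\<^sup>2)"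
      by (simp add: power2_sum add_ac)
    also have "\<dots> = (f y)\<^sup>2 + real n * measure_pmf.expectation p (\<lambda>y. (f y)\<^sup>2)"
      using sum_int Suc.IH by simp
    finally show "measure_pmf.expectation (replicate_pmf n p) (\<lambda>ys. (\<Sum>z\<leftarrow>y # ys. f z)\<^sup>2) =
       (f y)\<^sup>2 + real n * measure_pmf.expectation p (\<lambda>y. (f y)\<^sup>2)" .
  qed
  also have "\<dots> = real (Suc n) * measure_pmf.expectation p (\<lambda>y. (f y)\<^sup>2)"
    using f_int by (simp add: algebra_simps)
  finally show "measure_pmf.expectation (replicate_pmf (Suc n) p) (\<lambda>ys. (\<Sum>y\<leftarrow>ys. f y)\<^sup>2) =
      real (Suc n) * measure_pmf.expectation p (\<lambda>y. (f y)\<^sup>2)" .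
qed

lemma Chebyshev_empirical_mean:
  fixes f :: "'a \<Rightarrow> real"
  assumes bound: "\<And>y. \<bar>f y\<bar> \<le> 1" and "T > 0" "e > 0"
  shows "measure_pmf.prob (replicate_pmf T p)
      {ys. \<bar>(\<Sum>y\<leftarrow>ys. f y - measure_pmf.expectation p f)\<bar> \<ge> real T * e} \<le> 4 / (real T * e\<^sup>2)"
proof -
  define g where "g y = f y - measure_pmf.expectation p f" for y
  have "\<bar>measure_pmf.expectation p f\<bar> \<le> 1"
    using norm_expectation_pmf_le[of p f 1] bound by simp
  \<comment> \<open>Centring at most doubles the bound 1; squared, this is the constant 4 of the
    conclusion.\<close>
  then have g_bound: "\<bar>g y\<bar> \<le> 2" for y
    using bound[of y] by (simp add: g_def)
  have "integrable (measure_pmf p) f"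
    using bound by (auto intro!: integrable_pmf_bounded[where B = 1])
  then have mean: "measure_pmf.expectation p g = 0"
    unfolding g_def by (subst Bochner_Integration.integral_diff) auto
  have sq: "(g y)\<^sup>2 \<le> 4" for y
    using power_mono[OF g_bound abs_ge_zero, of y 2] by simp
  have sum_bound: "\<bar>\<Sum>y\<leftarrow>ys. g y\<bar> \<le> real T * 2" if "ys \<in> set_pmf (replicate_pmf T p)" for ys
    using abs_sum_list_le[of ys g 2] g_bound that by (auto simp: set_replicate_pmf)
  have sq_int: "integrable (measure_pmf (replicate_pmf T p)) (\<lambda>ys. (\<Sum>y\<leftarrow>ys. g y)\<^sup>2)"
    by (rule integrable_pmf_bounded[where B = "(real T * 2)\<^sup>2"])
       (use power_mono[OF sum_bound abs_ge_zero, of _ 2] in auto)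
  have "measure_pmf.prob (replicate_pmf T p)
      {ys \<in> space (replicate_pmf T p). \<bar>(\<Sum>y\<leftarrow>ys. g y)\<bar> \<ge> real T * e} \<le>
      measure_pmf.expectation (replicate_pmf T p) (\<lambda>ys. (\<Sum>y\<leftarrow>ys. g y)\<^sup>2) / (real T * e)\<^sup>2"
    by (rule measure_pmf.second_moment_method) (use assms sq_int in auto)
  also have "\<dots> = real T * measure_pmf.expectation p (\<lambda>y. (g y)\<^sup>2) / (real T * e)\<^sup>2"
    by (simp add: moments_sum_list_replicate_pmf(2)[OF g_bound mean])
  also have "\<dots> \<le> real T * 4 / (real T * e)\<^sup>2"
    using norm_expectation_pmf_le[of p "\<lambda>y. (g y)\<^sup>2" 4] sq
    by (intro divide_right_mono mult_left_mono) auto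
  also have "\<dots> = 4 / (real T * e\<^sup>2)"
    using assms by (simp add: field_simps power2_eq_square)
  finally show ?thesis by (simp add: g_def)
qed

section \<open>Sign polynomials and their means under the channel\<close>

definition bit_sign :: "bool \<Rightarrow> real" where
  "bit_sign b = (if b then 1 else -1)"

text \<open>Horner form, so that it unfolds along the same list recursion as
  \<open>insertion_channel\<close>.\<close>

primrec sign_poly :: "bool list \<Rightarrow> complex \<Rightarrow> complex" where
  "sign_poly [] z = 0"
| "sign_poly (b # y) z = of_real (bit_sign b) + z * sign_poly y z"

text \<open>The value 0 past the end matches a missing coefficient of \<open>sign_poly\<close>, so a
  mean at position \<open>j\<close> makes sense for outputs of random length.\<close>

definition sign_at :: "nat \<Rightarrow> bool list \<Rightarrow> real" where
  "sign_at j y = (if j < length y then bit_sign (y ! j) else 0)"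

definition mean_sign :: "real \<Rightarrow> bool list \<Rightarrow> nat \<Rightarrow> real" where
  "mean_sign \<beta> x j = measure_pmf.expectation (insertion_channel \<beta> x) (sign_at j)"

text \<open>The probability generating function of the geometric law on the naturals from 0, in
  closed form.\<close>

definition gap_transform :: "real \<Rightarrow> complex \<Rightarrow> complex" where
  "gap_transform \<beta> w = of_real (1 - \<beta>) / (1 - of_real \<beta> * w)"

lemma abs_bit_sign [simp]: "\<bar>bit_sign b\<bar> = 1"
  by (simp add: bit_sign_def)

lemma abs_sign_at_le: "\<bar>sign_at j y\<bar> \<le> 1"
  by (simp add: sign_at_def)

lemma sign_poly_append: "sign_poly (u @ v) z = sign_poly u z + z ^ length u * sign_poly v z"
  by (induction u) (auto simp: algebra_simps)

text \<open>A geometric series dominates, as all coefficients have modulus 1. The bound is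
  independent of the length of \<open>y\<close>, which gives integrability over outputs of unbounded
  length.\<close>

lemma norm_sign_poly_le:
  assumes "norm z < 1"
  shows "norm (sign_poly y z) \<le> 1 / (1 - norm z)"
proof (induction y)
  case (Cons b y)
  have "norm (sign_poly (b # y) z) \<le> 1 + norm z * norm (sign_poly y z)"
    using norm_triangle_ineq[of "complex_of_real (bit_sign b)" "z * sign_poly y z"]
    by (simp add: norm_mult)
  also have "\<dots> \<le> 1 + norm z * (1 / (1 - norm z))"
    using Cons.IH by (intro add_left_mono mult_left_mono) auto
  also have "\<dots> = 1 / (1 - norm z)"
    using assms by (simp add: field_simps)
  finally show ?case .
qed (use assms in simp)

lemma holomorphic_sign_poly [holomorphic_intros]:
  assumes "f holomorphic_on A"
  shows "(\<lambda>z. sign_poly y (f z)) holomorphic_on A"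
  by (induction y) (auto intro!: holomorphic_intros assms)

text \<open>Allows only finitely many positions to be tested: the remainder carries the small factor
  \<open>z ^ J\<close> and is again a sign polynomial, hence bounded by
  \<open>norm_sign_poly_le\<close>.\<close>

lemma sign_poly_truncate:
  "sign_poly y z = (\<Sum>j<J. of_real (sign_at j y) * z ^ j) + z ^ J * sign_poly (drop J y) z"
proof (induction J arbitrary: y)
  case (Suc J)
  show ?case
  proof (cases y)
    case (Cons b y')
    have "(\<Sum>j<Suc J. of_real (sign_at j y) * z ^ j) =
        of_real (bit_sign b) + z * (\<Sum>j<J. of_real (sign_at j y') * z ^ j)"
      unfolding sum.lessThan_Suc_shift
      by (simp add: Cons sign_at_def sum_distrib_left mult_ac cong: if_cong)
    then show ?thesis
      using Suc.IH[of y'] by (simp add: Cons algebra_simps)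
  qed (simp add: sign_at_def)
qed simp

lemma integrable_sign_poly:
  "norm z < 1 \<Longrightarrow> integrable (measure_pmf p) (\<lambda>y. sign_poly y z)"
  by (rule integrable_pmf_bounded) (rule norm_sign_poly_le)

lemma expectation_sign_poly_fair_bits:
  assumes z: "norm z < 1"
  shows "measure_pmf.expectation (replicate_pmf m (pmf_of_set (UNIV :: bool set)))
           (\<lambda>u. sign_poly u z) = 0"
proof (induction m)
  case (Suc m)
  let ?p = "pmf_of_set (UNIV :: bool set)" and ?q = "replicate_pmf m (pmf_of_set (UNIV :: bool set))"
  have eq: "replicate_pmf (Suc m) ?p = bind_pmf ?p (\<lambda>b. map_pmf ((#) b) ?q)"
    by (simp add: map_pmf_def)
  \<comment> \<open>By induction the later bits contribute zero, so only the sign of the first bit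
    is left.\<close>
  have "measure_pmf.expectation (replicate_pmf (Suc m) ?p) (\<lambda>u. sign_poly u z) =
      measure_pmf.expectation ?p (\<lambda>b. of_real (bit_sign b))"
    unfolding eq
    by (subst expectation_bind_pmf_complex[where B = "1 / (1 - norm z)"])
       (auto simp del: sign_poly.simps simp: norm_sign_poly_le z, 
        simp add: integrable_sign_poly[OF z] Suc.IH)
  also have "\<dots> = 0"
    by (simp add: integral_pmf_of_set UNIV_bool bit_sign_def)
  finally show ?case .
qed simp

lemma expectation_sign_poly_inserted_bits:
  assumes "norm z < 1"
  shows "measure_pmf.expectation (inserted_bits_pmf \<beta>) (\<lambda>u. sign_poly u z) = 0"
  unfolding inserted_bits_pmf_def
  by (subst expectation_bind_pmf_complex[where B = "1 / (1 - norm z)"])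
     (simp_all add: assms norm_sign_poly_le expectation_sign_poly_fair_bits)

text \<open>The \<open>Suc\<close> in \<open>gap_pmf\<close> cancels against the
  \<open>g - 1\<close> in \<open>inserted_bits_pmf\<close>.\<close>

lemma map_length_inserted_bits: "map_pmf length (inserted_bits_pmf \<beta>) = geometric_pmf (1 - \<beta>)"
proof -
  have len: "map_pmf length (replicate_pmf m p) = return_pmf m" for m and p :: "bool pmf"
    by (subst map_pmf_cong[where g = "\<lambda>_. m" and q = "replicate_pmf m p"])
       (auto simp: set_replicate_pmf)
  show ?thesis
    by (simp add: inserted_bits_pmf_def gap_pmf_def map_bind_pmf bind_map_pmf len bind_return_pmf')
qed

lemma one_minus_mult_nonzero:
  assumes "0 \<le> \<beta>" "\<beta> < 1" "norm w \<le> 1"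
  shows "1 - complex_of_real \<beta> * w \<noteq> 0"
proof
  assume "1 - complex_of_real \<beta> * w = 0"
  then have "complex_of_real \<beta> * w = 1" by simp
  then have "norm (complex_of_real \<beta> * w) = 1" by simp
  moreover have "norm (complex_of_real \<beta> * w) \<le> \<beta> * 1"
    unfolding norm_mult using assms by (intro mult_mono) auto
  ultimately show False using assms by simp
qed

text \<open>Conditioning on the first trial gives the linear equation E = (1 - \<beta>) + \<beta> w
  E, whose coefficient 1 - \<beta> w is nonzero on the closed disc.\<close>

lemma expectation_power_geometric:
  assumes "0 \<le> \<beta>" "\<beta> < 1" "norm w \<le> 1"
  shows "measure_pmf.expectation (geometric_pmf (1 - \<beta>)) (\<lambda>k. w ^ k) = gap_transform \<beta> w"
proof -
  define E where "E = measure_pmf.expectation (geometric_pmf (1 - \<beta>)) (\<lambda>k. w ^ k)"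
  let ?q = "\<lambda>b. if b then return_pmf 0 else map_pmf Suc (geometric_pmf (1 - \<beta>))"
  have "E = measure_pmf.expectation (bind_pmf (bernoulli_pmf (1 - \<beta>)) ?q) (\<lambda>k. w ^ k)"
    unfolding E_def by (subst geometric_bind_pmf_unfold) (use assms in auto)
  also have "\<dots> = measure_pmf.expectation (bernoulli_pmf (1 - \<beta>))
      (\<lambda>b. measure_pmf.expectation (?q b) (\<lambda>k. w ^ k))"
    by (rule expectation_bind_pmf_complex[where B = 1])
       (use assms in \<open>auto simp: norm_power norm_mult power_le_one intro!: mult_le_one\<close>)
  also have "\<dots> = of_real (1 - \<beta>) + of_real \<beta> * (w * E)"
    by (subst integral_measure_pmf[where A = UNIV])
       (use assms in \<open>auto simp: E_def scaleR_conv_of_real UNIV_bool\<close>)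
  finally have "E * (1 - of_real \<beta> * w) = of_real (1 - \<beta>)"
    by (simp add: algebra_simps)
  then show ?thesis
    using one_minus_mult_nonzero[OF assms] by (simp add: E_def gap_transform_def field_simps)
qed

text \<open>The fair bits have mean sign zero, so only the randomly shifted input bits survive.\<close>

lemma expectation_sign_poly_channel:
  assumes "0 \<le> \<beta>" "\<beta> < 1" "norm w < 1"
  shows "measure_pmf.expectation (insertion_channel \<beta> x) (\<lambda>y. sign_poly y w) =
    gap_transform \<beta> w * sign_poly x (w * gap_transform \<beta> w)"
proof (induction x)
  case Nil
  then show ?case by (simp add: expectation_sign_poly_inserted_bits assms)
next
  case (Cons b x)
  let ?E = "measure_pmf.expectation (insertion_channel \<beta> x) (\<lambda>y. sign_poly y w)"
  let ?B = "1 / (1 - norm w)"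
  have eq: "insertion_channel \<beta> (b # x) =
      bind_pmf (inserted_bits_pmf \<beta>) (\<lambda>u. map_pmf (\<lambda>v. u @ b # v) (insertion_channel \<beta> x))"
    by (simp add: map_pmf_def)
  have pow: "integrable (measure_pmf (inserted_bits_pmf \<beta>)) (\<lambda>u. w ^ length u)"
    by (rule integrable_pmf_bounded[where B = 1]) (use assms in \<open>simp add: norm_power power_le_one\<close>)
  have "measure_pmf.expectation (insertion_channel \<beta> (b # x)) (\<lambda>y. sign_poly y w) =
      measure_pmf.expectation (inserted_bits_pmf \<beta>) (\<lambda>u. measure_pmf.expectation
        (map_pmf (\<lambda>v. u @ b # v) (insertion_channel \<beta> x)) (\<lambda>y. sign_poly y w))"
    unfolding eq
    by (rule expectation_bind_pmf_complex[where B = ?B]) (rule norm_sign_poly_le[OF assms(3)])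
  also have "\<dots> = measure_pmf.expectation (inserted_bits_pmf \<beta>)
      (\<lambda>u. sign_poly u w + w ^ length u * (of_real (bit_sign b) + w * ?E))"
    by (simp add: sign_poly_append integrable_sign_poly[OF assms(3)])
  also have "\<dots> = measure_pmf.expectation (map_pmf length (inserted_bits_pmf \<beta>)) (\<lambda>k. w ^ k) *
      (of_real (bit_sign b) + w * ?E)"
    using pow by (simp add: integrable_sign_poly[OF assms(3)]
        expectation_sign_poly_inserted_bits[OF assms(3)])
  also have "\<dots> = gap_transform \<beta> w * (of_real (bit_sign b) + w * ?E)"
    unfolding map_length_inserted_bits using assms by (simp add: expectation_power_geometric)
  finally show ?case
    using Cons.IH by (simp add: algebra_simps)
qed

lemma norm_mean_sign_generating_function_diff_le:
  assumes "norm w < 1"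
  shows "norm (measure_pmf.expectation (insertion_channel \<beta> x) (\<lambda>y. sign_poly y w)
      - (\<Sum>j<J. of_real (mean_sign \<beta> x j) * w ^ j)) \<le> norm w ^ J / (1 - norm w)"
proof -
  let ?p = "insertion_channel \<beta> x"
  have int_sign: "integrable (measure_pmf ?p) (\<lambda>y. complex_of_real (sign_at j y))" for j
    by (rule integrable_pmf_bounded[where B = 1]) (simp add: abs_sign_at_le)
  have tail: "norm (w ^ J * sign_poly (drop J y) w) \<le> norm w ^ J / (1 - norm w)" for y
    using mult_left_mono[OF norm_sign_poly_le[OF assms, of "drop J y"], of "norm w ^ J"]
    by (simp add: norm_mult norm_power)
  have "measure_pmf.expectation ?p (\<lambda>y. sign_poly y w) =
      measure_pmf.expectation ?p (\<lambda>y. (\<Sum>j<J. of_real (sign_at j y) * w ^ j)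
        + w ^ J * sign_poly (drop J y) w)"
    by (simp flip: sign_poly_truncate)
  also have "\<dots> = measure_pmf.expectation ?p (\<lambda>y. \<Sum>j<J. of_real (sign_at j y) * w ^ j)
      + measure_pmf.expectation ?p (\<lambda>y. w ^ J * sign_poly (drop J y) w)"
    by (rule Bochner_Integration.integral_add)
       (use int_sign integrable_pmf_bounded[OF tail] in auto)
  also have "measure_pmf.expectation ?p (\<lambda>y. \<Sum>j<J. of_real (sign_at j y) * w ^ j) =
      (\<Sum>j<J. of_real (mean_sign \<beta> x j) * w ^ j)"
    using int_sign by (simp add: mean_sign_def)
  finally show ?thesis
    using norm_expectation_pmf_le[of ?p, OF tail] by simp
qed

section \<open>Lower bound near 1 from the maximum principle\<close>

text \<open>Rounding the angle of \<open>u\<close> down to a multiple of 2 pi / N selects the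
  rotation. The angle left over is at most 2 pi / N, and a chord is no longer than its arc.\<close>

lemma exists_rotation_near_one:
  assumes "norm u = 1" "N > 0"
  shows "\<exists>k<N. norm (1 - u * cis (- (2 * pi * real k / real N))) \<le> 2 * pi / real N"
proof -
  obtain t where t: "0 \<le> t" "t < 2 * pi" "u = cis t"
    using Arg2pi[of u] assms by (metis cis_conv_exp complex_norm_eq_1_exp mult_1 of_real_1)
  define k where "k = nat \<lfloor>real N * t / (2 * pi)\<rfloor>"
  have k: "real k \<le> real N * t / (2 * pi)" "real N * t / (2 * pi) < real k + 1"
    using t by (auto simp: k_def)
  have "real N * t / (2 * pi) < real N"
    using t assms by (simp add: field_simps)
  then have "k < N" using k by linarith
  define s where "s = t - 2 * pi * real k / real N"
  have s: "s = (real N * t - 2 * pi * real k) / real N"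
    using assms by (simp add: s_def field_simps)
  have "0 \<le> s" "s \<le> 2 * pi / real N"
    unfolding s using k by (intro divide_nonneg_nonneg divide_right_mono; simp add: field_simps)+
  moreover have "norm (1 - cis s) \<le> \<bar>s\<bar>"
    using iexp_approx1[of s 0] by (simp add: norm_minus_commute cis_conv_exp)
  moreover have "u * cis (- (2 * pi * real k / real N)) = cis s"
    by (simp add: t s_def cis_mult)
  ultimately show ?thesis using \<open>k < N\<close> by auto
qed

text \<open>Multiply the \<open>N\<close> rotations of \<open>g\<close>: at every boundary point one factor is evaluated near \<open>1\<close>.\<close>

lemma exists_large_value_near_one:
  fixes g :: "complex \<Rightarrow> complex"
  assumes hol: "g holomorphic_on ball 0 1" and cont: "continuous_on (cball 0 1) g"
    and g0: "1 \<le> norm (g 0)" and M: "1 < M" and bound: "\<And>v. norm v = 1 \<Longrightarrow> norm (g v) \<le> M"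
    and N: "N > 0"
  shows "\<exists>v. norm v = 1 \<and> norm (1 - v) \<le> 2 * pi / real N \<and> 1 / M ^ N \<le> norm (g v)"
proof (rule ccontr)
  assume "\<not> ?thesis"
  then have small: "norm (g v) \<le> 1 / M ^ N" if "norm v = 1" "norm (1 - v) \<le> 2 * pi / real N" for v
    using that by (meson linear)
  define c where "c k = cis (- (2 * pi * real k / real N))" for k
  define G where "G = (\<lambda>u. \<Prod>k<N. g (u * c k))"
  have "norm (G 0) \<le> 1 / M"
  proof (rule maximum_modulus_frontier[where f = G and S = "cball 0 1"])
    have "(g \<circ> (\<lambda>u. u * c k)) holomorphic_on ball 0 1" for k
      by (rule holomorphic_on_compose_gen[OF _ hol])
         (auto intro!: holomorphic_intros simp: norm_mult c_def image_subset_iff)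
    then show "G holomorphic_on interior (cball 0 1)"
      by (auto simp: G_def o_def intro!: holomorphic_intros)
    have "continuous_on (cball 0 1) (\<lambda>u. g (u * c k))" for k
      by (rule continuous_on_compose2[OF cont]) (auto intro!: continuous_intros simp: norm_mult c_def)
    then show "continuous_on (closure (cball 0 1)) G"
      by (auto simp: G_def intro!: continuous_intros)
    show "norm (G u) \<le> 1 / M" if "u \<in> frontier (cball 0 1)" for u
    proof -
      have u: "norm u = 1" using that by (simp add: frontier_cball)
      then obtain k where k: "k < N" "norm (1 - u * c k) \<le> 2 * pi / real N"
        using exists_rotation_near_one[OF u N] by (auto simp: c_def)
      have "norm (G u) = norm (g (u * c k)) * (\<Prod>l\<in>{..<N} - {k}. norm (g (u * c l)))"
        using k by (simp add: G_def prod.remove norm_mult prod_norm)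
      \<comment> \<open>One small factor outweighs the other N - 1 factors, each at most
        \<open>M\<close>, leaving 1 / M < 1. At the centre, however, the product is
        \<open>g 0 ^ N\<close>, of modulus at least 1.\<close>
      also have "\<dots> \<le> 1 / M ^ N * (\<Prod>l\<in>{..<N} - {k}. M)"
        using k u M by (intro mult_mono prod_mono small prod_nonneg)
          (auto simp: norm_mult c_def intro!: bound)
      also have "\<dots> = 1 / M"
        using k M by (cases N) (auto simp: field_simps)
      finally show ?thesis .
    qed
  qed auto
  moreover have "norm (G 0) \<ge> 1"
    using g0 by (simp add: G_def norm_power one_le_power)
  moreover have "1 / M < 1" using M by simp
  ultimately show False by linarith
qed

section \<open>Geometry of the substitution near 1\<close>

text \<open>Shows that the squared denominator of \<open>gap_transform\<close> exceeds its value (1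
  - \<beta>)^2 at \<open>w = 1\<close> only through 1 - |w|^2 and |1 - w|^2, both of which are
  O(1/N^2) at the points used later.\<close>

lemma norm_one_minus_mult_sq:
  "(norm (1 - complex_of_real \<beta> * w))\<^sup>2 =
     (1 - \<beta>) * (1 - \<beta> * (norm w)\<^sup>2) + \<beta> * (norm (1 - w))\<^sup>2"
  unfolding cmod_power2 by (simp add: power2_eq_square algebra_simps)

lemma norm_gap_transform_le:
  assumes "0 \<le> \<beta>" "\<beta> < 1" "norm w \<le> 1"
  shows "norm (gap_transform \<beta> w) \<le> 1"
proof -
  have "norm (complex_of_real \<beta> * w) \<le> \<beta> * 1"
    unfolding norm_mult using assms by (intro mult_mono) auto
  then have "1 - \<beta> \<le> norm (1 - complex_of_real \<beta> * w)"
    using norm_triangle_ineq2[of 1 "complex_of_real \<beta> * w"] by simp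
  moreover have "norm (complex_of_real (1 - \<beta>)) = 1 - \<beta>"
    using assms by (simp del: of_real_diff)
  ultimately show ?thesis
    unfolding gap_transform_def norm_divide using assms by (simp add: divide_le_eq_1)
qed

lemma norm_one_plus_unit:
  fixes v :: complex
  assumes "norm v = 1"
  shows "(norm (1 + v))\<^sup>2 = 4 - (norm (1 - v))\<^sup>2"
proof -
  have "(norm v)\<^sup>2 = 1" using assms by simp
  then show ?thesis
    unfolding cmod_power2 by (simp add: power2_eq_square algebra_simps)
qed

text \<open>With s = |1 - v|^2 this is sqrt(1 - s/4) \<le> 1 - s/8. The quadratic gap it provides is
  what lets (1 - v)^2 absorb a pole of order one in 1 - |z|.\<close>

lemma half_norm_one_plus_unit_le:
  fixes v :: complex
  assumes "norm v = 1"
  shows "norm (1 + v) / 2 \<le> 1 - (norm (1 - v))\<^sup>2 / 8"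
proof (rule power2_le_imp_le)
  define s where "s = (norm (1 - v))\<^sup>2"
  have s: "s \<le> 4" "0 \<le> s" using norm_one_plus_unit[OF assms] unfolding s_def
    by (smt (verit) zero_le_power2)+
  have "(norm (1 + v) / 2)\<^sup>2 = 1 - s / 4"
    using norm_one_plus_unit[OF assms] by (simp add: power_divide s_def field_simps)
  also have "\<dots> \<le> (1 - s / 8)\<^sup>2" by (simp add: power2_eq_square algebra_simps)
  finally show "(norm (1 + v) / 2)\<^sup>2 \<le> (1 - (norm (1 - v))\<^sup>2 / 8)\<^sup>2" by (simp add: s_def)
  show "0 \<le> 1 - (norm (1 - v))\<^sup>2 / 8" using s by (simp add: s_def)
qed

text \<open>With \<open>x\<close> = 1/N^2, the numerator satisfies |w|^2 \<ge> 1 - 15 x and the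
  squared denominator is at most (1 - \<beta>)^2 + 159 x; each estimate then becomes an exponential.
  Powers of order N^3 therefore cost only exp(-O(N)).\<close>

lemma norm_channel_map_ge:
  fixes N :: nat
  assumes \<beta>: "0 \<le> \<beta>" "\<beta> < 1" and N: "N \<ge> 10"
    and v: "norm v = 1" "norm (1 - v) \<le> 7 / real N"
    and w: "w = of_real (1 - 1 / (real N)\<^sup>2) * v * (1 + v) / 2"
  shows "exp (- (30 + 159 / (1 - \<beta>)\<^sup>2) / (real N)\<^sup>2) \<le> (norm (w * gap_transform \<beta> w))\<^sup>2"
proof -
  define \<alpha> where "\<alpha> = 1 - \<beta>"
  define x where "x = 1 / (real N)\<^sup>2"
  have "real N \<ge> 10" using N by simp
  then have "(real N)\<^sup>2 \<ge> 10\<^sup>2" by (intro power_mono) auto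
  then have x: "0 < x" "x \<le> 1 / 100" using N by (auto simp: x_def divide_le_eq)
  have \<alpha>: "0 < \<alpha>" "\<alpha> \<le> 1" using \<beta> by (auto simp: \<alpha>_def)
  have nx: "norm (1 - complex_of_real x) = 1 - x"
  proof -
    have "norm (complex_of_real (1 - x)) = 1 - x" using x by (simp del: of_real_diff)
    then show ?thesis by simp
  qed
  have v2: "(norm (1 - v))\<^sup>2 \<le> 49 * x"
    using power_mono[OF v(2), of 2] by (simp add: x_def power_divide)
  have w2: "(norm w)\<^sup>2 = (1 - x)\<^sup>2 * (1 - (norm (1 - v))\<^sup>2 / 4)"
  proof -
    have "norm w = (1 - x) * norm (1 + v) / 2"
      by (simp add: w norm_mult norm_divide v(1) nx flip: x_def)
    then show ?thesis
      by (simp only: power_mult_distrib power_divide norm_one_plus_unit[OF v(1)]) (simp add: field_simps)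
  qed
  \<comment> \<open>The 49 is the square of the 7 in the distance bound on \<open>v\<close>; the
    linear loss 2 + 49/4 is below 15.\<close>
  have "(1 - x)\<^sup>2 * (1 - (norm (1 - v))\<^sup>2 / 4) \<ge> (1 - 2 * x) * (1 - 49 * x / 4)"
  proof (intro mult_mono)
    show "1 - 2 * x \<le> (1 - x)\<^sup>2" by (simp add: power2_eq_square algebra_simps)
  qed (use v2 x in auto)
  moreover have "(1 - 2 * x) * (1 - 49 * x / 4) \<ge> 1 - 15 * x"
    using x by (simp add: algebra_simps)
  ultimately have w_ge: "(norm w)\<^sup>2 \<ge> 1 - 15 * x" using w2 by simp
  \<comment> \<open>Separates the effect of the radius, of order 1/N^2, from that of the angle, of
    order 1/N. First order suffices because only |1 - w|^2 enters the denominator.\<close>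
  have eq: "1 - w = of_real x * (v * (1 + v) / 2) + (1 - v) * (2 + v) / 2"
    unfolding w x_def[symmetric] by (simp add: field_simps)
  have t1: "norm (of_real x * (v * (1 + v) / 2)) \<le> x"
  proof -
    have "norm (1 + v) \<le> 2" using norm_triangle_ineq[of 1 v] v by simp
    then show ?thesis using x v by (simp add: norm_mult norm_divide)
  qed
  have t2: "norm ((1 - v) * (2 + v) / 2) \<le> 7 / real N * 3 / 2"
  proof -
    have "norm (2 + v) \<le> 3" using norm_triangle_ineq[of 2 v] v by simp
    then have "norm (1 - v) * norm (2 + v) \<le> 7 / real N * 3"
      using v by (intro mult_mono) auto
    then show ?thesis by (simp add: norm_mult norm_divide)
  qed
  have "x \<le> 1 / real N"
    using N by (simp add: x_def power2_eq_square field_simps)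
  moreover have "norm (1 - w) \<le> x + 7 / real N * 3 / 2"
    unfolding eq using norm_triangle_mono[OF t1 t2] .
  \<comment> \<open>Here 1 + 21/2 = 11.5 is rounded up to 12, whose square is 144.\<close>
  moreover have "1 / real N + 7 / real N * 3 / 2 \<le> 12 / real N"
    using N by (simp add: field_simps)
  ultimately have "norm (1 - w) \<le> 12 / real N" by linarith
  then have w1: "(norm (1 - w))\<^sup>2 \<le> 144 * x"
    using power_mono[of "norm (1 - w)" "12 / real N" 2] by (simp add: x_def power_divide)
  have den: "(norm (1 - complex_of_real \<beta> * w))\<^sup>2 \<le> \<alpha>\<^sup>2 + 159 * x"
  proof -
    have "(norm (1 - complex_of_real \<beta> * w))\<^sup>2 = \<alpha> * (1 - \<beta> * (norm w)\<^sup>2) + \<beta> * (norm (1 - w))\<^sup>2"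
      by (simp add: norm_one_minus_mult_sq \<alpha>_def)
    also have "\<dots> \<le> \<alpha> * (1 - \<beta> * (1 - 15 * x)) + \<beta> * (144 * x)"
      using w_ge w1 \<alpha> \<beta> by (intro add_mono mult_left_mono diff_left_mono) auto
    also have "\<dots> = \<alpha>\<^sup>2 + (\<alpha> * \<beta>) * (15 * x) + \<beta> * (144 * x)"
      by (simp add: \<alpha>_def power2_eq_square algebra_simps)
    \<comment> \<open>The 159 is 15 + 144, with \<alpha> \<beta> and \<beta> bounded by 1.\<close>
    also have "\<dots> \<le> \<alpha>\<^sup>2 + 1 * (15 * x) + 1 * (144 * x)"
      using \<alpha> \<beta> x by (intro add_mono mult_right_mono mult_le_one) auto
    finally show ?thesis by simp
  qed
  have den_pos: "(norm (1 - complex_of_real \<beta> * w))\<^sup>2 > 0"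
  proof -
    have "norm w \<le> 1"
    proof -
      have "norm (1 + v) \<le> 2" using norm_triangle_ineq[of 1 v] v by simp
      then have "(1 - x) * (norm (1 + v) / 2) \<le> 1 * 1" using x by (intro mult_mono) auto
      then show ?thesis by (simp add: w norm_mult norm_divide v(1) nx flip: x_def)
    qed
    then show ?thesis using one_minus_mult_nonzero \<beta> by simp
  qed
  have "exp (- (30 + 159 / (1 - \<beta>)\<^sup>2) / (real N)\<^sup>2) = exp (- (30 * x)) * exp (- (159 * x / \<alpha>\<^sup>2))"
    by (simp add: x_def \<alpha>_def exp_add[symmetric] diff_divide_distrib mult.commute)
  also have "\<dots> \<le> (1 - 15 * x) * (\<alpha>\<^sup>2 / (\<alpha>\<^sup>2 + 159 * x))"
  proof (intro mult_mono)
    \<comment> \<open>True for 0 \<le> x \<le> 1/30; \<open>N \<ge> 10\<close> gives x \<le>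
      1/100.\<close>
    have "1 \<le> (1 - 15 * x) * (1 + 30 * x)" using x by (simp add: algebra_simps)
    also have "\<dots> \<le> (1 - 15 * x) * exp (30 * x)"
      using x by (intro mult_left_mono exp_ge_add_one_self) auto
    finally show "exp (- (30 * x)) \<le> 1 - 15 * x" by (simp add: exp_minus field_simps)
    have "1 + 159 * x / \<alpha>\<^sup>2 \<le> exp (159 * x / \<alpha>\<^sup>2)" by (rule exp_ge_add_one_self)
    moreover have "\<alpha>\<^sup>2 / (\<alpha>\<^sup>2 + 159 * x) = inverse (1 + 159 * x / \<alpha>\<^sup>2)"
      using \<alpha> x by (simp add: field_simps)
    ultimately show "exp (- (159 * x / \<alpha>\<^sup>2)) \<le> \<alpha>\<^sup>2 / (\<alpha>\<^sup>2 + 159 * x)"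
      unfolding exp_minus using \<alpha> x by (auto intro!: le_imp_inverse_le add_pos_nonneg)
  qed (use x in auto)
  also have "\<dots> \<le> (norm w)\<^sup>2 * (\<alpha>\<^sup>2 / (norm (1 - complex_of_real \<beta> * w))\<^sup>2)"
  proof (intro mult_mono divide_left_mono)
    show "0 < (\<alpha>\<^sup>2 + 159 * x) * (norm (1 - complex_of_real \<beta> * w))\<^sup>2"
      using den_pos x by (intro mult_pos_pos add_nonneg_pos) auto
  qed (use w_ge den x in auto)
  also have "\<dots> = (norm (w * gap_transform \<beta> w))\<^sup>2"
  proof -
    have "norm (complex_of_real (1 - \<beta>)) = \<alpha>" using \<alpha> by (simp add: \<alpha>_def del: of_real_diff)
    then show ?thesis
      unfolding gap_transform_def norm_mult norm_divide by (simp add: power_mult_distrib power_divide)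
  qed
  finally show ?thesis .
qed

section \<open>Separating two inputs by mean signs\<close>

text \<open>\<open>A\<close> is the difference of two sign polynomials after division by the power
  of z at the first disagreement, where the bits are \<open>b\<close> and \<open>c\<close>. The
  radius 1 - 1/N^2 keeps \<open>W v\<close> in the open disc, where the generating functions
  converge.\<close>

lemma exists_large_sign_poly_value:
  fixes N :: nat
  assumes \<beta>: "0 \<le> \<beta>" "\<beta> < 1" and N: "N \<ge> 10" and "b \<noteq> c"
    and A: "A = (\<lambda>z. of_real (bit_sign b - bit_sign c) + z * (sign_poly x z - sign_poly y z))"
    and W: "W = (\<lambda>v. of_real (1 - 1 / (real N)\<^sup>2) * v * (1 + v) / 2)"
  shows "\<exists>v. norm v = 1 \<and> norm (1 - v) \<le> 7 / real N \<and>
    1 / (2 * 8 ^ N) \<le> norm (A (W v * gap_transform \<beta> (W v)))"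
proof -
  define r where "r = 1 - 1 / (real N)\<^sup>2"
  have "(real N)\<^sup>2 \<ge> 10\<^sup>2" using N by (intro power_mono) auto
  then have r: "0 \<le> r" "r < 1" using N by (auto simp: r_def divide_le_eq)
  have normW: "norm (W v) = r * norm v * (norm (1 + v) / 2)" for v
    unfolding W using r by (simp add: norm_mult norm_divide flip: r_def)
  have half: "norm (1 + v) / 2 \<le> 1" if "norm v \<le> 1" for v :: complex
    using norm_triangle_ineq[of 1 v] that by simp
  have W_le: "norm (W v) \<le> r" if "norm v \<le> 1" for v
  proof -
    have "r * norm v * (norm (1 + v) / 2) \<le> r * 1 * 1"
      using r that half[OF that] by (intro mult_mono) auto
    then show ?thesis unfolding normW by simp
  qed
  \<comment> \<open>On the unit circle \<open>A\<close> is at most \<open>2 / (1 - \<bar>W v\<bar>)\<close>, and the factor \<open>(1 - v)\<^sup>2\<close> cancels exactly this pole at \<open>1\<close>.\<close>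
  define g where "g = (\<lambda>v. A (W v * gap_transform \<beta> (W v)) * (1 - v)\<^sup>2 / 2)"
  have hol: "g holomorphic_on cball 0 1"
  proof -
    have "1 - complex_of_real \<beta> * W v \<noteq> 0" if "v \<in> cball 0 1" for v
      using one_minus_mult_nonzero[OF \<beta>, of "W v"] W_le[of v] that r by auto
    then show ?thesis
      unfolding g_def A gap_transform_def W by (auto intro!: holomorphic_intros)
  qed
  have "\<exists>v. norm v = 1 \<and> norm (1 - v) \<le> 2 * pi / real N \<and> 1 / 8 ^ N \<le> norm (g v)"
  proof (rule exists_large_value_near_one)
    show "g holomorphic_on ball 0 1"
      by (rule holomorphic_on_subset[OF hol]) auto
    show "continuous_on (cball 0 1) g"
      by (rule holomorphic_on_imp_continuous_on[OF hol])
    show "1 \<le> norm (g 0)"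
      using \<open>b \<noteq> c\<close> by (auto simp: g_def W A bit_sign_def)
    show "norm (g v) \<le> 8" if v: "norm v = 1" for v
    proof -
      define z where "z = W v * gap_transform \<beta> (W v)"
      have "norm z \<le> norm (W v) * 1"
        unfolding z_def norm_mult
        using norm_gap_transform_le[OF \<beta>, of "W v"] W_le[of v] v r
        by (intro mult_left_mono) auto
      \<comment> \<open>Replacing the radius by 1 makes the bound depend on \<open>v\<close> alone,
        so \<open>half_norm_one_plus_unit_le\<close> applies to \<open>norm z\<close>.\<close>
      moreover have "norm (W v) \<le> 1 * (norm (1 + v) / 2)"
        unfolding normW using v r by (intro mult_right_mono) auto
      ultimately have z: "norm z < 1" "(norm (1 - v))\<^sup>2 \<le> 8 * (1 - norm z)"
        using W_le[of v] r v half_norm_one_plus_unit_le[OF v] by auto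
      have "norm (A z) \<le> \<bar>bit_sign b - bit_sign c\<bar> + norm z * norm (sign_poly x z - sign_poly y z)"
        unfolding A using norm_triangle_ineq[of "complex_of_real (bit_sign b - bit_sign c)"]
        by (metis norm_mult norm_of_real)
      also have "\<dots> \<le> 2 + norm z * (1 / (1 - norm z) + 1 / (1 - norm z))"
        using norm_triangle_ineq4[of "sign_poly x z" "sign_poly y z"]
          norm_sign_poly_le[OF z(1), of x] norm_sign_poly_le[OF z(1), of y]
        by (intro add_mono mult_left_mono) (auto simp: bit_sign_def)
      also have "\<dots> = 2 / (1 - norm z)"
        using z by (simp add: field_simps)
      finally have "norm (A z) * (norm (1 - v))\<^sup>2 \<le> 2 / (1 - norm z) * (8 * (1 - norm z))"
        using z by (intro mult_mono) auto
      also have "\<dots> = 16"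
        using z by (simp add: field_simps)
      finally show ?thesis
        by (simp add: g_def norm_mult norm_divide norm_power flip: z_def)
    qed
  qed (use N in auto)
  then obtain v where v: "norm v = 1" "norm (1 - v) \<le> 2 * pi / real N" "1 / 8 ^ N \<le> norm (g v)"
    by blast
  have "2 * pi / real N \<le> 7 / real N"
    using pi_approx by (intro divide_right_mono) auto
  then have v7: "norm (1 - v) \<le> 7 / real N" using v by simp
  \<comment> \<open>Hence |1 - v|^2 \<le> 4 and |g v| \<le> 2 |A|, the origin of the factor 2 in
    front of \<open>8 ^ N\<close>.\<close>
  have "norm (1 - v) \<le> 2" using norm_triangle_ineq4[of 1 v] v by simp
  then have "(norm (1 - v))\<^sup>2 \<le> 2\<^sup>2" by (intro power_mono) auto
  then have "norm (A (W v * gap_transform \<beta> (W v))) * (norm (1 - v))\<^sup>2 \<le>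
      norm (A (W v * gap_transform \<beta> (W v))) * 4"
    by (intro mult_left_mono) auto
  then have "norm (g v) \<le> norm (A (W v * gap_transform \<beta> (W v))) * 4 / 2"
    by (simp add: g_def norm_mult norm_divide norm_power)
  then have "1 / 8 ^ N \<le> 2 * norm (A (W v * gap_transform \<beta> (W v)))"
    using v(3) by simp
  then show ?thesis
    using v v7 by (intro exI[of _ v]) (simp add: divide_le_eq mult_ac)
qed

lemma exists_separating_position:
  assumes \<beta>: "0 \<le> \<beta>" "\<beta> < 1"
  shows "\<exists>q::nat. q > 0 \<and> (\<forall>(N::nat) x y. N \<ge> 10 \<longrightarrow> length x \<le> N ^ 3 \<longrightarrow> length x = length y \<longrightarrow>
    x \<noteq> y \<longrightarrow> (\<exists>j<q * N ^ 3. exp (- (real q * real N)) \<le> \<bar>mean_sign \<beta> x j - mean_sign \<beta> y j\<bar>))"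
proof -
  define C where "C = 30 + 159 / (1 - \<beta>)\<^sup>2"
  \<comment> \<open>The contradiction needs q > C + 8: one 4 pays for \<open>2 * 8 ^ N\<close>,
    another for \<open>3 * (real N)\<^sup>2\<close>. The same \<open>q\<close> governs the number of
    positions and the exponent of the separation.\<close>
  define q where "q = nat \<lceil>C\<rceil> + 10"
  have q: "real q \<ge> C + 10" "q > 0" unfolding q_def by (auto simp: real_nat_ceiling_ge)
  have "\<exists>j<q * N ^ 3. exp (- (real q * real N)) \<le> \<bar>mean_sign \<beta> x j - mean_sign \<beta> y j\<bar>"
    if N: "N \<ge> 10" and len: "length x \<le> N ^ 3" "length x = length y" and "x \<noteq> y" for N :: nat and x y
  proof (rule ccontr)
    define J where "J = q * N ^ 3"
    define e where "e = exp (- (real q * real N))"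
    assume "\<not> ?thesis"
    then have small: "\<bar>mean_sign \<beta> x j - mean_sign \<beta> y j\<bar> \<le> e" if "j < J" for j
      using that unfolding J_def e_def by (meson linear)
    obtain p b x' c y' where xy: "b \<noteq> c" "x = p @ b # x'" "y = p @ c # y'"
      using same_length_different[OF \<open>x \<noteq> y\<close> len(2)] by auto
    define A where
      "A = (\<lambda>z. of_real (bit_sign b - bit_sign c) + z * (sign_poly x' z - sign_poly y' z))"
    have diff: "sign_poly x z - sign_poly y z = z ^ length p * A z" for z
      by (simp add: xy sign_poly_append A_def algebra_simps)
    define r where "r = 1 - 1 / (real N)\<^sup>2"
    have "(real N)\<^sup>2 \<ge> 10\<^sup>2" using N by (intro power_mono) auto
    then have r: "0 \<le> r" "r < 1" using N by (auto simp: r_def divide_le_eq)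
    have inv_r: "1 / (1 - r) = (real N)\<^sup>2" by (simp add: r_def)
    obtain v where v: "norm v = 1" "norm (1 - v) \<le> 7 / real N"
      and large: "1 / (2 * 8 ^ N) \<le> norm (A (of_real r * v * (1 + v) / 2 *
        gap_transform \<beta> (of_real r * v * (1 + v) / 2)))"
      using exists_large_sign_poly_value[OF \<beta> N xy(1) A_def refl] unfolding r_def by blast
    define w where "w = of_real r * v * (1 + v) / 2"
    define \<phi> where "\<phi> = w * gap_transform \<beta> w"
    have w_le: "norm w \<le> r"
    proof -
      have "norm w = r * (norm (1 + v) / 2)"
        using r v by (simp add: w_def norm_mult norm_divide)
      also have "\<dots> \<le> r * 1"
        using norm_triangle_ineq[of 1 v] v r by (intro mult_left_mono) auto
      finally show ?thesis by simp
    qed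
    then have w: "norm w < 1" using r by simp
    have \<phi>_sq: "exp (- C / (real N)\<^sup>2) \<le> (norm \<phi>)\<^sup>2"
      using norm_channel_map_ge[OF \<beta> N v, of w] unfolding \<phi>_def w_def r_def C_def by blast
    have \<phi>_le: "norm \<phi> \<le> norm (gap_transform \<beta> w)" "norm \<phi> \<le> 1"
      using w norm_gap_transform_le[OF \<beta>, of w]
      by (auto simp: \<phi>_def norm_mult intro!: mult_left_le_one_le mult_le_one)
    have \<phi>_ge: "exp (- C / (real N)\<^sup>2) \<le> norm \<phi>"
    proof -
      \<comment> \<open>As \<open>norm \<phi> \<le> 1\<close>, the bound for the square serves as a
        bound for \<open>norm \<phi>\<close> itself.\<close>
      have "(norm \<phi>)\<^sup>2 \<le> norm \<phi>"
        using \<phi>_le by (simp add: power2_eq_square mult_left_le)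
      then show ?thesis using \<phi>_sq by simp
    qed
    have "exp (- C * real N) = exp (- C / (real N)\<^sup>2) ^ (N ^ 3)"
      using N by (simp add: exp_of_nat_mult[symmetric] power2_eq_square power3_eq_cube)
    also have "\<dots> \<le> norm \<phi> ^ (N ^ 3)"
      using \<phi>_ge by (intro power_mono) auto
    \<comment> \<open>The common prefix is strictly shorter than \<open>x\<close>, so one more
      factor \<phi> is affordable; through
      \<open>norm \<phi> \<le> norm (gap_transform \<beta> w)\<close> it accounts for the prefactor
      of the generating function.\<close>
    also have "\<dots> \<le> norm \<phi> ^ Suc (length p)"
      using \<phi>_le len xy by (intro power_decreasing) auto
    finally have \<phi>_pow: "exp (- C * real N) \<le> norm \<phi> ^ Suc (length p)" .
    have eight: "exp (- 4 * real N) \<le> 1 / (2 * 8 ^ N)"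
    proof -
      have "(2::real) * 8 ^ N \<le> exp 1 ^ N * (exp 3) ^ N"
      proof (intro mult_mono power_mono)
        have e2: "(2::real) \<le> exp 1" using exp_ge_add_one_self[of 1] by simp
        then show "(2::real) \<le> exp 1 ^ N"
          using N self_le_power[of "exp (1::real)" N] by simp
        have "(2::real) ^ 3 \<le> exp 1 ^ 3" using e2 by (intro power_mono) auto
        then show "(8::real) \<le> exp 3" by (simp flip: exp_of_nat_mult)
      qed auto
      also have "\<dots> = exp (4 * real N)"
        by (simp flip: exp_of_nat_mult exp_add)
      finally show ?thesis by (simp add: exp_minus field_simps)
    qed
    let ?E = "\<lambda>x. measure_pmf.expectation (insertion_channel \<beta> x) (\<lambda>y. sign_poly y w)"
    let ?S = "\<lambda>x. \<Sum>j<J. of_real (mean_sign \<beta> x j) * w ^ j"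
    have "exp (- (C + 4) * real N) = exp (- C * real N) * exp (- 4 * real N)"
      by (simp add: algebra_simps flip: exp_add)
    also have "\<dots> \<le> norm \<phi> ^ Suc (length p) * norm (A \<phi>)"
      using \<phi>_pow eight large by (intro mult_mono) (auto simp: \<phi>_def w_def)
    also have "\<dots> \<le> norm (gap_transform \<beta> w) * (norm \<phi> ^ length p * norm (A \<phi>))"
      using mult_right_mono[OF \<phi>_le(1), of "norm \<phi> ^ length p * norm (A \<phi>)"] by (simp add: mult_ac)
    also have "\<dots> = norm (?E x - ?E y)"
      unfolding expectation_sign_poly_channel[OF \<beta> w] \<phi>_def[symmetric] right_diff_distrib[symmetric] diff
      by (simp add: norm_mult norm_power)
    finally have lower: "exp (- (C + 4) * real N) \<le> norm (?E x - ?E y)" .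
    have upper: "norm (?E x - ?E y) \<le> norm (?S x - ?S y) + (norm w ^ J / (1 - norm w) + norm w ^ J / (1 - norm w))"
    proof -
      have "norm (?E x - ?E y) = norm ((?S x - ?S y) + ((?E x - ?S x) - (?E y - ?S y)))"
        by (simp add: algebra_simps)
      also have "\<dots> \<le> norm (?S x - ?S y) + (norm (?E x - ?S x) + norm (?E y - ?S y))"
        by (rule norm_triangle_le[OF add_left_mono[OF norm_triangle_ineq4]])
      finally show ?thesis
        using norm_mean_sign_generating_function_diff_le[OF w, of \<beta> x J]
          norm_mean_sign_generating_function_diff_le[OF w, of \<beta> y J] by linarith
    qed
    have head: "norm (?S x - ?S y) \<le> e * (real N)\<^sup>2"
    proof -
      have "norm (?S x - ?S y) = norm (\<Sum>j<J. of_real (mean_sign \<beta> x j - mean_sign \<beta> y j) * w ^ j)"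
        by (simp add: sum_subtractf algebra_simps)
      also have "\<dots> \<le> (\<Sum>j<J. e * r ^ j)"
      proof (rule sum_norm_le)
        fix j assume "j \<in> {..<J}"
        then have "\<bar>mean_sign \<beta> x j - mean_sign \<beta> y j\<bar> * norm w ^ j \<le> e * r ^ j"
          using small w_le by (intro mult_mono power_mono) (auto simp: e_def)
        then show "norm (complex_of_real (mean_sign \<beta> x j - mean_sign \<beta> y j) * w ^ j) \<le> e * r ^ j"
          by (simp add: norm_mult norm_power del: of_real_diff)
      qed
      also have "\<dots> = e * ((1 - r ^ J) / (1 - r))"
        using r by (simp add: sum_gp_strict flip: sum_distrib_left)
      also have "\<dots> \<le> e * (1 / (1 - r))"
        using r by (intro mult_left_mono divide_right_mono) (auto simp: e_def)
      finally show ?thesis unfolding inv_r .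
    qed
    have tail: "norm w ^ J / (1 - norm w) \<le> e * (real N)\<^sup>2"
    proof -
      have "norm w ^ J / (1 - norm w) \<le> r ^ J / (1 - r)"
        using r w_le by (intro frac_le power_mono) auto
      also have "\<dots> = r ^ J * (real N)\<^sup>2"
        unfolding inv_r[symmetric] by simp
      \<comment> \<open>Since r = 1 - 1/N^2 and J = q N^3, truncating at \<open>J\<close> makes the
        tail as small as the assumed separation \<open>e\<close>.\<close>
      also have "r ^ J \<le> exp (- 1 / (real N)\<^sup>2) ^ J"
        using r exp_ge_add_one_self[of "- 1 / (real N)\<^sup>2"] by (intro power_mono) (auto simp: r_def)
      also have "\<dots> = e"
        using N by (simp add: e_def J_def exp_of_nat_mult[symmetric] power2_eq_square power3_eq_cube)
      finally show ?thesis by (simp add: mult_right_mono)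
    qed
    \<comment> \<open>Three equal terms: the sum over the tested positions and the two
      tails.\<close>
    have "exp (- (C + 4) * real N) \<le> 3 * (e * (real N)\<^sup>2)"
      using lower upper head tail by linarith
    also have "\<dots> = 3 * (real N)\<^sup>2 * e" by simp
    also have "\<dots> \<le> exp (2 * real N) * exp (2 * real N) * e"
    proof -
      have N_exp: "real N \<le> exp (real N)" using exp_ge_add_one_self[of "real N"] by linarith
      have "(real N)\<^sup>2 \<le> exp (real N) ^ 2" using N_exp by (intro power_mono) auto
      also have "\<dots> = exp (2 * real N)" by (simp flip: exp_of_nat_mult)
      finally have "(real N)\<^sup>2 \<le> exp (2 * real N)" .
      moreover have "3 \<le> exp (2 * real N)"
        using exp_ge_add_one_self[of "2 * real N"] N by linarith
      ultimately show ?thesis by (intro mult_mono mult_right_mono) (auto simp: e_def)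
    qed
    also have "\<dots> = exp ((4 - real q) * real N)"
      by (simp add: e_def algebra_simps flip: exp_add)
    finally have "(- (C + 4)) * real N \<le> (4 - real q) * real N" by simp
    then have "- (C + 4) \<le> 4 - real q" using N by simp
    then show False using q by simp
  qed
  then show ?thesis using q by blast
qed

section \<open>The estimator and the number of samples\<close>

text \<open>Choose a string whose mean signs are all within e/2 of the empirical ones. Two such
  strings would differ by less than \<open>e\<close> at every position, against \<open>sep\<close>,
  so the choice is forced. The true input qualifies unless one of \<open>J\<close> Chebyshev events
  occurs.\<close>

lemma exists_estimator:
  assumes sep: "\<And>x y. length x = n \<Longrightarrow> length y = n \<Longrightarrow> x \<noteq> y \<Longrightarrow>
      \<exists>j<J. e \<le> \<bar>mean_sign \<beta> x j - mean_sign \<beta> y j\<bar>"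
    and "e > 0" "T > 0"
  shows "\<exists>est :: bool list list \<Rightarrow> bool list. (\<forall>ys. length (est ys) = n) \<and>
    (\<forall>x. length x = n \<longrightarrow> 1 - 16 * real J / (real T * e\<^sup>2) \<le>
      measure_pmf.prob (replicate_pmf T (insertion_channel \<beta> x)) {ys. est ys = x})"
proof -
  define fits where "fits ys x \<longleftrightarrow> length x = n \<and>
    (\<forall>j<J. \<bar>\<Sum>y\<leftarrow>ys. sign_at j y - mean_sign \<beta> x j\<bar> < real T * (e / 2))"
    for ys :: "bool list list" and x
  \<comment> \<open>The default only secures length \<open>n\<close> when no string fits.\<close>
  define est where "est ys = (if \<exists>x. fits ys x then SOME x. fits ys x else replicate n False)" for ys
  have est: "length (est ys) = n" for ys
  proof (cases "\<exists>x. fits ys x")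
    case True
    then have "fits ys (est ys)" using someI_ex[of "fits ys"] by (simp add: est_def)
    then show ?thesis by (simp add: fits_def)
  qed (simp add: est_def)
  have est_eq: "est ys = x" if ys: "length ys = T" and x: "fits ys x" for ys x
  proof (rule ccontr)
    assume "est ys \<noteq> x"
    moreover have z: "fits ys (est ys)"
      using x someI[of "fits ys" x] by (auto simp: est_def)
    ultimately obtain j where j: "j < J" "e \<le> \<bar>mean_sign \<beta> (est ys) j - mean_sign \<beta> x j\<bar>"
      using sep[of "est ys" x] x by (auto simp: fits_def)
    have sum: "(\<Sum>y\<leftarrow>ys. sign_at j y - m) = (\<Sum>y\<leftarrow>ys. sign_at j y) - real T * m" for m
      unfolding ys[symmetric] by (simp add: sum_list_subtractf sum_list_const_mult sum_list_triv)
    have "\<bar>\<Sum>y\<leftarrow>ys. sign_at j y - mean_sign \<beta> x j\<bar> < real T * (e / 2)"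
      "\<bar>\<Sum>y\<leftarrow>ys. sign_at j y - mean_sign \<beta> (est ys) j\<bar> < real T * (e / 2)"
      using x z j(1) by (auto simp: fits_def)
    then have "\<bar>real T * mean_sign \<beta> (est ys) j - real T * mean_sign \<beta> x j\<bar> < real T * e"
      unfolding sum by linarith
    then have "real T * \<bar>mean_sign \<beta> (est ys) j - mean_sign \<beta> x j\<bar> < real T * e"
      by (simp add: abs_mult flip: right_diff_distrib)
    then show False using j(2) \<open>T > 0\<close> by simp
  qed
  have "1 - 16 * real J / (real T * e\<^sup>2) \<le>
      measure_pmf.prob (replicate_pmf T (insertion_channel \<beta> x)) {ys. est ys = x}"
    if "length x = n" for x
  proof -
    let ?P = "replicate_pmf T (insertion_channel \<beta> x)"
    define bad where "bad j = {ys. \<bar>\<Sum>y\<leftarrow>ys. sign_at j y - mean_sign \<beta> x j\<bar> \<ge> real T * (e / 2)}" for j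
    \<comment> \<open>Chebyshev at deviation e/2 turns the constant 4 into 16.\<close>
    have bad: "measure_pmf.prob ?P (bad j) \<le> 16 / (real T * e\<^sup>2)" for j
      using Chebyshev_empirical_mean[of "sign_at j" T "e / 2" "insertion_channel \<beta> x"]
        abs_sign_at_le \<open>T > 0\<close> \<open>e > 0\<close>
      by (simp add: bad_def mean_sign_def power_divide)
    have "1 - measure_pmf.prob ?P {ys. est ys = x} = measure_pmf.prob ?P (- {ys. est ys = x})"
      using measure_pmf.prob_compl[of "{ys. est ys = x}" ?P] by (simp add: Compl_eq_Diff_UNIV)
    also have "\<dots> \<le> measure_pmf.prob ?P (\<Union>j<J. bad j)"
    proof (rule measure_pmf.finite_measure_mono_AE)
      show "AE ys in ?P. ys \<in> - {ys. est ys = x} \<longrightarrow> ys \<in> (\<Union>j<J. bad j)"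
      proof (rule AE_pmfI, intro impI)
        fix ys assume "ys \<in> set_pmf ?P" "ys \<in> - {ys. est ys = x}"
        then have "\<not> fits ys x" using est_eq by (auto simp: set_replicate_pmf)
        then show "ys \<in> (\<Union>j<J. bad j)" using that by (auto simp: fits_def bad_def not_less)
      qed
    qed simp
    also have "\<dots> \<le> (\<Sum>j<J. measure_pmf.prob ?P (bad j))"
      by (rule measure_pmf.finite_measure_subadditive_finite) auto
    also have "\<dots> \<le> (\<Sum>j<J. 16 / (real T * e\<^sup>2))"
      by (rule sum_mono) (rule bad)
    finally show ?thesis by simp
  qed
  then show ?thesis using est by blast
qed

theorem theorem5p1:
  fixes \<beta> \<delta> :: real
  assumes "0 \<le> \<beta>" and "\<beta> < 1" and "\<delta> > 0"
  shows "\<exists>C::real. \<forall>n::nat. n \<ge> 1 \<longrightarrow>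
           (let T = nat \<lceil>exp (C * real n powr (1/3))\<rceil> in
             \<exists>est :: bool list list \<Rightarrow> bool list.
               (\<forall>ys. length ys = T \<longrightarrow> length (est ys) = n) \<and>
               (\<forall>x :: bool list. length x = n \<longrightarrow>
                  measure_pmf.prob (replicate_pmf T (insertion_channel \<beta> x))
                    {ys. est ys = x} \<ge> 1 - \<delta>))"
proof -
  obtain q :: nat where "q > 0" and sep:
    "\<And>N x y. N \<ge> 10 \<Longrightarrow> length x \<le> N ^ 3 \<Longrightarrow> length x = length y \<Longrightarrow> x \<noteq> y \<Longrightarrow>
      \<exists>j<q * N ^ 3. exp (- (real q * real N)) \<le> \<bar>mean_sign \<beta> x j - mean_sign \<beta> y j\<bar>"
    using exists_separating_position[OF assms(1,2)] by blast
  \<comment> \<open>The absolute value makes D nonnegative, so that 16 q / \<delta> \<le> exp (D m)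
    for every m \<ge> 1.\<close>
  define D where "D = \<bar>ln (16 * real q / \<delta>)\<bar>"
  \<comment> \<open>Since N \<le> 11 m, this pays for
    \<open>real N ^ 3 \<le> exp (3 * real N)\<close> and for the factor exp (2 q N) from dividing by
    \<open>e\<^sup>2\<close>.\<close>
  define C where "C = D + 11 * (3 + 2 * real q)"
  have "let T = nat \<lceil>exp (C * real n powr (1/3))\<rceil> in
             \<exists>est :: bool list list \<Rightarrow> bool list.
               (\<forall>ys. length ys = T \<longrightarrow> length (est ys) = n) \<and>
               (\<forall>x :: bool list. length x = n \<longrightarrow>
                  measure_pmf.prob (replicate_pmf T (insertion_channel \<beta> x))
                    {ys. est ys = x} \<ge> 1 - \<delta>)" if "n \<ge> 1" for n :: nat
  proof -
    define m where "m = real n powr (1/3)"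
    define T where "T = nat \<lceil>exp (C * m)\<rceil>"
    \<comment> \<open>The factor 10 ensures N \<ge> 10 already for n = 1; N \<ge> m gives n \<le>
      N^3, and rounding up costs at most one further m.\<close>
    define N where "N = nat \<lceil>10 * m\<rceil>"
    define e where "e = exp (- (real q * real N))"
    have m: "m \<ge> 1" using that by (simp add: m_def ge_one_powr_ge_zero)
    have m3: "m ^ 3 = real n"
      using that by (simp add: m_def powr_powr flip: powr_realpow)
    have N: "10 * m \<le> real N" "real N \<le> 11 * m"
      using m unfolding N_def by linarith+
    have "N \<ge> 10" using N m by linarith
    have "m ^ 3 \<le> real N ^ 3" using N m by (intro power_mono) auto
    then have "n \<le> N ^ 3" unfolding m3 by (metis of_nat_le_iff of_nat_power)
    have T: "exp (C * m) \<le> real T" unfolding T_def by linarith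
    then have "T > 0" using less_le_trans[OF exp_gt_zero] by (metis of_nat_0_less_iff)
    have "\<exists>j<q * N ^ 3. e \<le> \<bar>mean_sign \<beta> x j - mean_sign \<beta> y j\<bar>"
      if "length x = n" "length y = n" "x \<noteq> y" for x y
      unfolding e_def using sep[of N x y] that \<open>N \<ge> 10\<close> \<open>n \<le> N ^ 3\<close> by simp
    then obtain est where est: "\<And>ys. length (est ys) = n"
      "\<And>x. length x = n \<Longrightarrow> 1 - 16 * real (q * N ^ 3) / (real T * e\<^sup>2) \<le>
        measure_pmf.prob (replicate_pmf T (insertion_channel \<beta> x)) {ys. est ys = x}"
      using exists_estimator[of n "q * N ^ 3" e \<beta> T] \<open>T > 0\<close> by (auto simp: e_def)
    have "16 * real (q * N ^ 3) / (real T * e\<^sup>2) \<le> \<delta>"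
    proof -
      have "16 * real q / \<delta> = exp (ln (16 * real q / \<delta>))"
        using \<open>q > 0\<close> assms by simp
      also have "\<dots> \<le> exp (D * m)"
        using mult_left_mono[OF m, of D] by (simp add: D_def)
      finally have "16 * real q / \<delta> \<le> exp (D * m)" .
      moreover have "real N ^ 3 \<le> exp (3 * real N)"
      proof -
        have "real N \<le> exp (real N)"
          using exp_ge_add_one_self[of "real N"] by linarith
        then have "real N ^ 3 \<le> exp (real N) ^ 3"
          by (intro power_mono) auto
        then show ?thesis by (simp flip: exp_of_nat_mult)
      qed
      ultimately have "16 * real q / \<delta> * real N ^ 3 \<le> exp (D * m) * exp (3 * real N)"
        by (intro mult_mono) auto
      also have "\<dots> = exp (D * m + (3 + 2 * real q) * real N) * e\<^sup>2"
        by (simp add: e_def power2_eq_square algebra_simps flip: exp_add)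
      also have "\<dots> \<le> exp (C * m) * e\<^sup>2"
        using mult_left_mono[OF N(2), of "3 + 2 * real q"]
        by (intro mult_right_mono) (auto simp: C_def algebra_simps)
      also have "\<dots> \<le> real T * e\<^sup>2"
        using T by (intro mult_right_mono) auto
      finally show ?thesis
        using assms \<open>T > 0\<close> by (simp add: e_def field_simps)
    qed
    then have "1 - \<delta> \<le> measure_pmf.prob (replicate_pmf T (insertion_channel \<beta> x)) {ys. est ys = x}"
      if "length x = n" for x
      using est(2)[OF that] by linarith
    then show ?thesis
      unfolding Let_def m_def[symmetric] T_def[symmetric] using est(1) by blast
  qed
  then show ?thesis by blast
qed

end
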